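(* There exist functions $\varphi : \mathbb{R} \to \mathbb{R}$, $\psi_1 : \mathbb{R} \to \mathbb{R}$ and $\psi_2 : \mathbb{R} \to \mathbb{R}$ such that \[ \varphi\left(\frac{x+y}{2}\right)\bigl(\psi_1(x)-\psi_2(y)\bigr)=0 \qquad \text{for all } x \in \mathbb{R} \text{ and } y \in \mathbb{R}, \] each of $\varphi$, $\psi_1$, $\psi_2$ is a Darboux function, and none of the functions $\varphi$, $\psi_1$, $\psi_2$ is continuous at any point $x \in \mathbb{R}$.
   Context: For a nonempty interval $I \subseteq \mathbb{R}$, a function $f : I \to \mathbb{R}$ is called Darboux (has the Darboux property) if for all $x, y \in I$ with $x<y$ and $f(x) \neq f(y)$, and for every $\lambda$ with $\min\{f(x),f(y)\} < \lambda < \max\{f(x),f(y)\}$, there exists $z$ with $x<z<y$ such that $f(z)=\lambda$. The real line carries its standard topology. *)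

theory Defs
  imports Complex_Main
begin

(* The domain I is meant to be a nonempty interval. The intermediate point z
   then lies in I automatically, being between two points of I. *)
definition darboux_on :: "real set \<Rightarrow> (real \<Rightarrow> real) \<Rightarrow> bool" where
  "darboux_on I f \<longleftrightarrow>
    (\<forall>x\<in>I. \<forall>y\<in>I. x < y \<and> f x \<noteq> f y \<longrightarrow>
      (\<forall>l. min (f x) (f y) < l \<and> l < max (f x) (f y) \<longrightarrow>
        (\<exists>z. x < z \<and> z < y \<and> f z = l)))"

end

theory Submission
  imports Defs "HOL-Analysis.Continuum_Not_Denumerable"
begin

text \<open>
  Choose a Hamel basis of the reals over the rationals and split it into three parts,
  each as large as the whole basis. Two of them yield \<open>\<rat>\<close>-linear maps \<open>L\<close>, \<open>M\<close> such that
  \<open>(L, M)\<close> maps the reals onto the plane; the third makes the common kernel nontrivial, hence dense,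
  so that \<open>(L, M)\<close> maps even every open interval onto the plane. Now take \<open>\<psi>1 = L\<close>, \<open>\<psi>2 = - L\<close>,
  and let \<open>\<phi>\<close> agree with \<open>M\<close> on the kernel of \<open>L\<close> and vanish elsewhere: by additivity,
  \<open>\<psi>1 x - \<psi>2 y = L (x + y)\<close>, which is zero whenever \<open>(x + y) / 2\<close> lies in the kernel of \<open>L\<close>.
\<close>

text \<open>Such functions are known as everywhere surjective; Conway's base 13 function is one.
  This single property yields both the Darboux property and discontinuity at every point.\<close>

definition strongly_darboux :: "(real \<Rightarrow> real) \<Rightarrow> bool" where
  "strongly_darboux f \<longleftrightarrow> (\<forall>a b v. a < b \<longrightarrow> (\<exists>z. a < z \<and> z < b \<and> f z = v))"

lemma strongly_darboux_imp_darboux_on: "strongly_darboux f \<Longrightarrow> darboux_on I f"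
  unfolding strongly_darboux_def darboux_on_def by blast

text \<open>Continuity would keep \<open>f\<close> within distance 1 of \<open>f x\<close> near
  \<open>x\<close>, yet the value \<open>f x + 1\<close> is attained arbitrarily close to
  \<open>x\<close>.\<close>

lemma strongly_darboux_imp_not_isCont:
  assumes "strongly_darboux f"
  shows "\<not> isCont f x"
proof
  assume "isCont f x"
  then have "f \<midarrow>x\<rightarrow> f x"
    by (simp add: isCont_def)
  from LIM_D[OF this, of 1] obtain d
    where d: "d > 0" "\<And>y. y \<noteq> x \<Longrightarrow> \<bar>y - x\<bar> < d \<Longrightarrow> \<bar>f y - f x\<bar> < 1"
    by auto
  have "x - d < x + d"
    using d(1) by simp
  then obtain z where z: "x - d < z" "z < x + d" "f z = f x + 1"
    using assms unfolding strongly_darboux_def by blast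
  then show False
    using d(2)[of z] by (cases "z = x") (auto simp: abs_less_iff)
qed

lemma strongly_darboux_uminus: "strongly_darboux f \<Longrightarrow> strongly_darboux (\<lambda>x. - f x)"
  unfolding strongly_darboux_def by (metis minus_minus)

interpretation rat_real: vector_space "\<lambda>q x. of_rat q * x :: real"
  by unfold_locales (simp_all add: algebra_simps of_rat_add of_rat_mult)

interpretation rat_real_pair:
  vector_space_pair "\<lambda>q x. of_rat q * x :: real" "\<lambda>q x. of_rat q * x :: real"
  by unfold_locales

lemma countable_rat_span: "finite S \<Longrightarrow> countable (rat_real.span S)"
proof (induction S rule: finite_induct)
  case (insert a S)
  have "rat_real.span (insert a S) \<subseteq> (\<lambda>(q, y). of_rat q * a + y) ` (UNIV \<times> rat_real.span S)"
  proof
    fix x assume "x \<in> rat_real.span (insert a S)"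
    then obtain q where "x - of_rat q * a \<in> rat_real.span S"
      by (auto simp: rat_real.span_insert)
    then show "x \<in> (\<lambda>(q, y). of_rat q * a + y) ` (UNIV \<times> rat_real.span S)"
      by (intro image_eqI[of _ _ "(q, x - of_rat q * a)"]) auto
  qed
  then show ?case
    using insert.IH by (meson countable_SIGMA countable_image countable_subset countableI_type)
qed simp

text \<open>A finite set has a countable rational span, while the reals are uncountable.\<close>

lemma infinite_rat_spanning:
  assumes "rat_real.span B = UNIV"
  shows "infinite B"
  using assms countable_rat_span uncountable_UNIV_real by metis

text \<open>For infinite \<open>B\<close>, multiplying by a nonempty finite set leaves the
  cardinality unchanged; \<open>h i\<close> is the slice at \<open>i\<close> of a bijection from
  \<open>B \<times> {..<3}\<close> to \<open>B\<close>.\<close>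

lemma infinite_inj_three_copies:
  includes cardinal_syntax
  assumes "infinite B"
  obtains h :: "nat \<Rightarrow> 'a \<Rightarrow> 'a"
  where "\<And>i b. i < (3::nat) \<Longrightarrow> b \<in> B \<Longrightarrow> h i b \<in> B"
    and "inj_on (\<lambda>(b, i). h i b) (B \<times> {..<3::nat})"
proof -
  have "|{..<3::nat}| \<le>o |B|"
    using assms by (intro ordLess_imp_ordLeq finite_ordLess_infinite)
      (simp_all add: Field_card_of card_of_well_order_on)
  then have "|B \<times> {..<3::nat}| =o |B|"
    using assms by (intro card_of_Times_infinite[THEN conjunct1]) (auto simp: lessThan_empty_iff)
  then obtain g where g: "bij_betw g (B \<times> {..<3::nat}) B"
    using card_of_ordIso by blast
  show ?thesis
  proof (rule that[of "\<lambda>i b. g (b, i)"])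
    show "g (b, i) \<in> B" if "i < 3" "b \<in> B" for i b
      using g that by (auto simp: bij_betw_def)
    show "inj_on (\<lambda>(b, i). g (b, i)) (B \<times> {..<3})"
      using g by (simp add: bij_betw_def)
  qed
qed

text \<open>The linear extensions \<open>J i\<close> of \<open>h i\<close> embed three independent
  copies of the reals; \<open>P i\<close> is a left inverse of \<open>J i\<close> that kills the
  other two copies. Copies 0 and 1 provide the coordinates of the plane, copy 2 the kernel vector
  \<open>c\<close>.\<close>

lemma rat_linear_onto_plane:
  obtains L M :: "real \<Rightarrow> real" and c :: real
  where "\<forall>x y. L (x + y) = L x + L y" "\<forall>x y. M (x + y) = M x + M y"
    and "\<forall>u v. \<exists>x. L x = u \<and> M x = v"
    and "c \<noteq> 0" "\<forall>q. L (of_rat q * c) = 0 \<and> M (of_rat q * c) = 0"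
proof -
  obtain B :: "real set" where ind: "\<not> rat_real.dependent B" and sp: "rat_real.span B = UNIV"
    using rat_real.basis_exists[of UNIV] by (metis top.extremum_uniqueI)
  note inf = infinite_rat_spanning[OF sp]
  obtain h :: "nat \<Rightarrow> real \<Rightarrow> real"
    where hB: "\<And>i b. i < (3::nat) \<Longrightarrow> b \<in> B \<Longrightarrow> h i b \<in> B"
    and inj: "inj_on (\<lambda>(b, i). h i b) (B \<times> {..<3::nat})"
    using infinite_inj_three_copies[OF inf] by blast
  have h_eq: "b = b' \<and> i = j" if "h i b = h j b'" "b \<in> B" "b' \<in> B" "i < 3" "j < 3" for i j b b'
    using inj_onD[OF inj, of "(b, i)" "(b', j)"] that by auto
  \<comment> \<open>\<open>p i\<close> inverts \<open>h i\<close> on its range; the default 0 makes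
    it kill the basis vectors of the other copies.\<close>
  define p where "p i b = (if \<exists>b'\<in>B. b = h i b' then THE b'. b' \<in> B \<and> b = h i b' else 0)" for i b
  have p: "p i (h j b) = (if i = j then b else 0)" if "b \<in> B" "i < 3" "j < 3" for i j b
  proof (cases "i = j")
    case True
    have "(THE b'. b' \<in> B \<and> h i b = h i b') = b"
      using that h_eq by (intro the_equality) blast+
    with True that show ?thesis
      by (auto simp: p_def)
  next
    case False
    then have "\<not> (\<exists>b'\<in>B. h j b = h i b')"
      using h_eq that by blast
    with False show ?thesis
      by (simp add: p_def)
  qed
  let ?lin = "Vector_Spaces.linear (\<lambda>q x. of_rat q * x :: real) (\<lambda>q x. of_rat q * x :: real)"
  have "\<exists>P. ?lin P \<and> (\<forall>b\<in>B. P b = p i b)" for i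
    using rat_real_pair.linear_independent_extend[OF ind] by blast
  then obtain P where P: "\<And>i. ?lin (P i)" "\<And>i b. b \<in> B \<Longrightarrow> P i b = p i b"
    by metis
  have "\<exists>J. ?lin J \<and> (\<forall>b\<in>B. J b = h i b)" for i
    using rat_real_pair.linear_independent_extend[OF ind] by blast
  then obtain J where J: "\<And>i. ?lin (J i)" "\<And>i b. b \<in> B \<Longrightarrow> J i b = h i b"
    by metis
  have P_add: "P i (x + y) = P i x + P i y" for i x y
    using P(1) by (rule rat_real_pair.linear_add)
  \<comment> \<open>Both sides are linear in \<open>x\<close> and agree on \<open>B\<close>, which
    spans.\<close>
  have PJ: "P i (J j x) = (if i = j then x else 0)" if "i < 3" "j < 3" for i j x
  proof -
    have on_basis: "P i (J j b) = (if i = j then b else 0)" if "b \<in> B" for b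
      using that \<open>i < 3\<close> \<open>j < 3\<close> by (simp add: J(2) P(2) hB p)
    have lin: "?lin (\<lambda>x. P i (J j x))"
      using Vector_Spaces.linear_compose[OF J(1) P(1)] by (simp add: o_def)
    have lin': "?lin (\<lambda>x. if i = j then x else 0)"
      by (cases "i = j") (auto simp: rat_real_pair.linear_zero rat_real.linear_ident)
    show ?thesis
      using rat_real_pair.linear_eq_on[OF lin lin', of x B] on_basis sp by auto
  qed
  obtain b where b: "b \<in> B" "b \<noteq> 0"
    using inf by (metis finite.emptyI finite.insertI finite_subset insertI1 subsetI)
  have "J 2 b \<noteq> 0"
    using PJ[of 2 2 b] b(2) rat_real_pair.linear_0[OF P(1), of 2] by auto
  moreover have "P i (of_rat q * J 2 b) = 0" if "i < 2" for i q
    using PJ[of i 2 b] that rat_real_pair.linear_scale[OF P(1), of i q "J 2 b"] by simp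
  moreover have "P 0 (J 0 u + J 1 v) = u \<and> P 1 (J 0 u + J 1 v) = v" for u v
    by (simp add: P_add PJ)
  ultimately show ?thesis
    using P_add by (intro that[of "P 0" "P 1" "J 2 b"]) (blast | simp)+
qed

text \<open>Translating by \<open>- x\<close> and dividing by \<open>c\<close> turns the interval
  into one that contains a rational; for negative \<open>c\<close> its endpoints swap.\<close>

lemma rat_multiple_between:
  fixes a b c x :: real
  assumes "a < b" "c \<noteq> 0"
  obtains q where "a < x + of_rat q * c" "x + of_rat q * c < b"
proof (cases "c > 0")
  case True
  then have "(a - x) / c < (b - x) / c"
    using assms by (simp add: divide_strict_right_mono)
  then obtain q where "(a - x) / c < of_rat q" "of_rat q < (b - x) / c"
    using of_rat_dense by blast
  with True show ?thesis
    by (intro that[of q]) (auto simp: field_simps)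
next
  case False
  then have c: "c < 0" using assms(2) by simp
  then have "(b - x) / c < (a - x) / c"
    using assms by (simp add: divide_strict_right_mono_neg)
  then obtain q where "(b - x) / c < of_rat q" "of_rat q < (a - x) / c"
    using of_rat_dense by blast
  with c show ?thesis
    by (intro that[of q]) (auto simp: field_simps)
qed

theorem theorem1:
  "\<exists>(\<phi> :: real \<Rightarrow> real) (\<psi>1 :: real \<Rightarrow> real) (\<psi>2 :: real \<Rightarrow> real).
    (\<forall>x y. \<phi> ((x + y) / 2) * (\<psi>1 x - \<psi>2 y) = 0) \<and>
    darboux_on UNIV \<phi> \<and> darboux_on UNIV \<psi>1 \<and> darboux_on UNIV \<psi>2 \<and>
    (\<forall>x. \<not> isCont \<phi> x) \<and> (\<forall>x. \<not> isCont \<psi>1 x) \<and> (\<forall>x. \<not> isCont \<psi>2 x)"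
proof -
  obtain L M :: "real \<Rightarrow> real" and c
    where L: "\<forall>x y. L (x + y) = L x + L y" and M: "\<forall>x y. M (x + y) = M x + M y"
      and onto: "\<forall>u v. \<exists>x. L x = u \<and> M x = v"
      and c: "c \<noteq> 0" "\<forall>q. L (of_rat q * c) = 0 \<and> M (of_rat q * c) = 0"
    by (rule rat_linear_onto_plane)
  \<comment> \<open>Shifting a preimage of \<open>(u, v)\<close> by rational multiples of
    \<open>c\<close> changes neither \<open>L\<close> nor \<open>M\<close>, and some shift lands in
    the interval.\<close>
  have onto_interval: "\<exists>z. a < z \<and> z < b \<and> L z = u \<and> M z = v" if ab: "a < b" for a b u v
  proof -
    obtain x where x: "L x = u" "M x = v"
      using onto by blast
    obtain q where q: "a < x + of_rat q * c" "x + of_rat q * c < b"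
      by (rule rat_multiple_between[OF ab c(1)])
    show ?thesis
      using q x c by (intro exI[of _ "x + of_rat q * c"]) (simp add: L[rule_format] M[rule_format])
  qed
  define \<phi> where "\<phi> x = (if L x = 0 then M x else 0)" for x
  have L_sd: "strongly_darboux L"
    unfolding strongly_darboux_def using onto_interval by blast
  then have uminus_L_sd: "strongly_darboux (\<lambda>x. - L x)"
    by (rule strongly_darboux_uminus)
  \<comment> \<open>Prescribing \<open>L z = 0\<close> together with \<open>M z = v\<close> places
    \<open>z\<close> where \<phi> agrees with \<open>M\<close>.\<close>
  have \<phi>_sd: "strongly_darboux \<phi>"
    unfolding strongly_darboux_def
  proof (intro allI impI)
    fix a b v :: real assume "a < b"
    then obtain z where "a < z" "z < b" "L z = 0" "M z = v"
      using onto_interval by blast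
    then show "\<exists>z. a < z \<and> z < b \<and> \<phi> z = v"
      by (auto simp: \<phi>_def)
  qed
  have "\<phi> ((x + y) / 2) * (L x - (- L y)) = 0" for x y
  proof -
    \<comment> \<open>Additivity, applied to the midpoint plus itself, supplies the factor 2. Hence
      the difference is nonzero only if the midpoint lies off the kernel of \<open>L\<close>, where
      \<phi> vanishes.\<close>
    have "L x - (- L y) = 2 * L ((x + y) / 2)"
      using L[rule_format, of x y] L[rule_format, of "(x + y) / 2" "(x + y) / 2"] by (simp only: field_sum_of_halves)
    then show ?thesis
      by (simp add: \<phi>_def)
  qed
  with L_sd uminus_L_sd \<phi>_sd show ?thesis
    by (intro exI[of _ \<phi>] exI[of _ L] exI[of _ "\<lambda>x. - L x"])
      (simp add: strongly_darboux_imp_darboux_on strongly_darboux_imp_not_isCont)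
qed

end
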